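(* Let $X\subseteq\mathbb{R}^n$ be open, let $\bar x\in X$, let $I$ be a nonempty finite index set, and let $f:X\to\mathbb{R}$ be given by $f(x)=\min_{i\in I} f_i(x)$ for all $x\in X$, where for every $i\in I$ $$f_i(x)=\max_{j\in J_i}\big(\langle a_{ij},x\rangle+b_{ij}\big),\qquad x\in X,$$ with $J_i$ a nonempty finite index set, $a_{ij}\in\mathbb{R}^n$ and $b_{ij}\in\mathbb{R}$. Then $$\bigcup_{\substack{p\in \mathcal{S}\\ f'(\bar x;p)>0}}\ \bigcap_{i\in I(\bar x,p)}\ \operatorname*{Arg\,max}_{v\in\partial f_i(\bar x)}\langle v,p\rangle\ =\ \operatorname*{Lim\,sup}_{\substack{x\to\bar x\\ f(x)>f(\bar x)}}\partial f(x).$$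
   Context: $\mathbb{R}^n$ carries the standard scalar product $\langle\cdot,\cdot\rangle$ and Euclidean norm $\|\cdot\|$; $\mathcal{S}$ is the unit sphere. The Hadamard directional derivative of $g:X\to\mathbb{R}$ at $x\in X$ in direction $p\in\mathbb{R}^n$ is $g'(x;p)=\lim_{t\downarrow 0,\ p'\to p}\frac{g(x+tp')-g(x)}{t}$ (it exists and is finite for the functions $f_i$ and $f$ considered here). The Fréchet subdifferential of $g:X\to\mathbb{R}$ at $x\in X$ is $$\partial g(x)=\Big\{v\in\mathbb{R}^n\ \Big|\ \liminf_{z\to x,\ z\neq x}\frac{g(z)-g(x)-\langle v,z-x\rangle}{\|z-x\|}\ge 0\Big\}.$$ Active index sets: $I(x)=\{i\in I\mid f_i(x)=f(x)\}$ and $$I(\bar x,p)=\Big\{i_0\in I(\bar x)\ \Big|\ \max_{v\in\partial f_{i_0}(\bar x)}\langle v,p\rangle=\min_{i\in I(\bar x)}\max_{v\in\partial f_i(\bar x)}\langle v,p\rangle\Big\}.$$ Outer limit: $\operatorname{Lim\,sup}_{x\to\bar x,\ f(x)>f(\bar x)}\partial f(x)$ is the set of all $y\in\mathbb{R}^n$ for which there exist sequences $x_k\to\bar x$ in $X$ with $f(x_k)>f(\bar x)$ and $y_k\in\partial f(x_k)$ with $y_k\to y$. *)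

theory Defs
  imports "HOL-Analysis.Analysis"
begin

text \<open>A function \<open>g : X \<rightarrow> \<real>\<close> is a total function whose values outside \<open>X\<close> are irrelevant;
  all limits below are restricted to the domain \<open>X\<close>.\<close>

text \<open>The filter for \<open>t \<down> 0\<close>, \<open>p' \<rightarrow> p\<close> uses \<open>nhds p\<close>, so that \<open>p' = p\<close> is allowed.\<close>

definition hadamard_deriv ::
    "'a::real_normed_vector set \<Rightarrow> ('a \<Rightarrow> real) \<Rightarrow> 'a \<Rightarrow> 'a \<Rightarrow> real" where
  "hadamard_deriv X g x p =
     Lim (inf (at_right 0 \<times>\<^sub>F nhds p) (principal {(t, p'). x + t *\<^sub>R p' \<in> X}))
         (\<lambda>(t, p'). (g (x + t *\<^sub>R p') - g x) / t)"

definition frechet_subdiff ::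
    "'a::real_inner set \<Rightarrow> ('a \<Rightarrow> real) \<Rightarrow> 'a \<Rightarrow> 'a set" where
  "frechet_subdiff X g x =
     {v. Liminf (at x within X) (\<lambda>z. ereal ((g z - g x - v \<bullet> (z - x)) / norm (z - x))) \<ge> 0}"

definition Argmax :: "('a \<Rightarrow> real) \<Rightarrow> 'a set \<Rightarrow> 'a set" where
  "Argmax h S = {v. is_arg_max h (\<lambda>u. u \<in> S) v}"

text \<open>The maximum of \<open>h\<close> over a possibly infinite set (the constant \<open>Max\<close> is only meaningful
  for finite sets).\<close>

definition max_value :: "('a \<Rightarrow> real) \<Rightarrow> 'a set \<Rightarrow> real" where
  "max_value h S = (GREATEST m. m \<in> h ` S)"

definition active :: "'i set \<Rightarrow> ('i \<Rightarrow> 'a \<Rightarrow> real) \<Rightarrow> ('a \<Rightarrow> real) \<Rightarrow> 'a \<Rightarrow> 'i set" where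
  "active I fi f x = {i \<in> I. fi i x = f x}"

definition active_dir ::
    "'a::real_inner set \<Rightarrow> 'i set \<Rightarrow> ('i \<Rightarrow> 'a \<Rightarrow> real) \<Rightarrow> ('a \<Rightarrow> real) \<Rightarrow> 'a \<Rightarrow> 'a \<Rightarrow> 'i set" where
  "active_dir X I fi f x p =
     {i0 \<in> active I fi f x.
        max_value (\<lambda>v. v \<bullet> p) (frechet_subdiff X (fi i0) x) =
        (MIN i\<in>active I fi f x. max_value (\<lambda>v. v \<bullet> p) (frechet_subdiff X (fi i) x))}"

definition outer_limit_subdiff ::
    "'a::real_inner set \<Rightarrow> ('a \<Rightarrow> real) \<Rightarrow> 'a \<Rightarrow> 'a set" where
  "outer_limit_subdiff X f x =
     {y. \<exists>xs ys. (\<forall>k::nat. xs k \<in> X \<and> f (xs k) > f x \<and> ys k \<in> frechet_subdiff X f (xs k)) \<and>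
                 xs \<longlonglongrightarrow> x \<and> ys \<longlonglongrightarrow> y}"

end

theory Submission
  imports Defs
begin

text \<open>
  Each \<open>fi i\<close> is convex, so its Frechet subdifferential consists of the global subgradients, and
  the subdifferential of the minimum is the intersection of those of the active \<open>fi i\<close>. Near \<open>xbar\<close>
  every \<open>fi i\<close> is \<open>fi i xbar\<close> plus a positively homogeneous function of the displacement; hence for
  small \<open>t > 0\<close> the subdifferential of \<open>f\<close> at \<open>xbar + t p\<close> is exactly the set attached to the
  direction \<open>p\<close> on the left-hand side, and \<open>f (xbar + t p) > f xbar\<close> iff \<open>f'(xbar; p) > 0\<close>. The outer
  limit adds nothing new because only finitely many sets, all closed, occur as subdifferentials
  of \<open>f\<close>.
\<close>

section \<open>Finite families of real functions: stable comparisons, maxima and minima\<close>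

lemma strict_order_persists:
  fixes g :: "'i \<Rightarrow> 'a::topological_space \<Rightarrow> real"
  assumes "finite J" and "\<And>j. j \<in> J \<Longrightarrow> (g j \<longlongrightarrow> g j x) (nhds x)"
  shows "\<forall>\<^sub>F z in nhds x. \<forall>i\<in>J. \<forall>j\<in>J. g i x < g j x \<longrightarrow> g i z < g j z"
proof (intro eventually_ball_finite ballI \<open>finite J\<close>)
  fix i j assume ij: "i \<in> J" "j \<in> J"
  show "\<forall>\<^sub>F z in nhds x. g i x < g j x \<longrightarrow> g i z < g j z"
  proof (cases "g i x < g j x")
    case True
    have "((\<lambda>z. g j z - g i z) \<longlongrightarrow> g j x - g i x) (nhds x)"
      using ij assms(2) by (intro tendsto_diff) auto
    from order_tendstoD(1)[OF this, of 0] True show ?thesis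
      by (auto elim: eventually_mono)
  qed auto
qed

text \<open>An index maximal for \<open>w\<close> is maximal for \<open>u\<close>, since a strictly
  larger \<open>u\<close> value would force a strictly larger \<open>w\<close> value. In use,
  \<open>u\<close> holds the values at a point and \<open>w\<close> those nearby: strict comparisons
  persist, while ties may break either way.\<close>

lemma Max_image_maximizers:
  fixes u w :: "'i \<Rightarrow> real"
  assumes "finite J" "J \<noteq> {}" and ord: "\<forall>i\<in>J. \<forall>j\<in>J. u i < u j \<longrightarrow> w i < w j"
  shows "Max (w ` J) = Max (w ` {j \<in> J. u j = Max (u ` J)})" (is "_ = Max (w ` ?A)")
proof -
  obtain k where k: "k \<in> J" "w k = Max (w ` J)"
    using Max_in[of "w ` J"] assms by fastforce
  have "u j \<le> u k" if "j \<in> J" for j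
  proof -
    have "w j \<le> w k" using k that \<open>finite J\<close> by simp
    then show ?thesis using ord k(1) that by (meson not_le)
  qed
  then have "k \<in> ?A"
    using k assms by (auto intro!: Max_eqI[symmetric])
  then have "w k \<in> w ` ?A" by (rule imageI)
  then have "Max (w ` ?A) = w k"
    unfolding k(2) using \<open>finite J\<close> by (intro Max_eqI) (auto intro: Max_ge)
  then show ?thesis using k by simp
qed

lemma Min_image_minimizers:
  fixes u w :: "'i \<Rightarrow> real"
  assumes "finite J" "J \<noteq> {}" and ord: "\<forall>i\<in>J. \<forall>j\<in>J. u i < u j \<longrightarrow> w i < w j"
  shows "Min (w ` J) = Min (w ` {j \<in> J. u j = Min (u ` J)})" (is "_ = Min (w ` ?A)")
proof -
  obtain k where k: "k \<in> J" "w k = Min (w ` J)"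
    using Min_in[of "w ` J"] assms by fastforce
  have "u k \<le> u j" if "j \<in> J" for j
  proof -
    have "w k \<le> w j" using k that \<open>finite J\<close> by simp
    then show ?thesis using ord k(1) that by (meson not_le)
  qed
  then have "k \<in> ?A"
    using k assms by (auto intro!: Min_eqI[symmetric])
  then have "w k \<in> w ` ?A" by (rule imageI)
  then have "Min (w ` ?A) = w k"
    unfolding k(2) using \<open>finite J\<close> by (intro Min_eqI) (auto intro: Min_le)
  then show ?thesis using k by simp
qed

lemma tendsto_Max_image:
  fixes g :: "'i \<Rightarrow> 'a \<Rightarrow> real"
  assumes "finite J" "J \<noteq> {}" and "\<And>j. j \<in> J \<Longrightarrow> (g j \<longlongrightarrow> l j) F"
  shows "((\<lambda>z. MAX j\<in>J. g j z) \<longlongrightarrow> (MAX j\<in>J. l j)) F"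
  using assms by (induction J rule: finite_ne_induct) (auto intro!: tendsto_max)

lemma tendsto_Min_image:
  fixes g :: "'i \<Rightarrow> 'a \<Rightarrow> real"
  assumes "finite J" "J \<noteq> {}" and "\<And>j. j \<in> J \<Longrightarrow> (g j \<longlongrightarrow> l j) F"
  shows "((\<lambda>z. MIN j\<in>J. g j z) \<longlongrightarrow> (MIN j\<in>J. l j)) F"
  using assms by (induction J rule: finite_ne_induct) (auto intro!: tendsto_min)

text \<open>\<open>GREATEST\<close> is specified only when the maximum is attained, so a maximizer
  \<open>v0\<close> is supplied explicitly.\<close>

lemma max_value_Argmax_eqI:
  assumes "v0 \<in> S" "h v0 = m" and le: "\<And>v. v \<in> S \<Longrightarrow> h v \<le> m"
  shows "max_value h S = m" and "Argmax h S = {v \<in> S. h v = m}"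
proof -
  show "max_value h S = m"
    unfolding max_value_def using assms by (intro Greatest_equality) auto
  show "Argmax h S = {v \<in> S. h v = m}"
    unfolding Argmax_def is_arg_max_def using assms by (auto simp: not_less intro: antisym)
qed

section \<open>Frechet subdifferentials\<close>

text \<open>Removes the extended-real liminf and the quotient. Multiplying by
  \<open>norm (z - x)\<close> is legitimate because the filter avoids \<open>z = x\<close>.\<close>

lemma mem_frechet_subdiff_iff:
  "v \<in> frechet_subdiff X g x \<longleftrightarrow>
     (\<forall>e>0. \<forall>\<^sub>F z in at x within X. g x + v \<bullet> (z - x) - e * norm (z - x) \<le> g z)"
proof -
  let ?q = "\<lambda>z. (g z - g x - v \<bullet> (z - x)) / norm (z - x)"
  have ne: "\<forall>\<^sub>F z in at x within X. z \<noteq> x"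
    by (simp add: eventually_at_filter)
  have q: "- e \<le> ?q z \<longleftrightarrow> g x + v \<bullet> (z - x) - e * norm (z - x) \<le> g z" if "z \<noteq> x" for z e
    using that by (simp add: field_simps)
  have "v \<in> frechet_subdiff X g x \<longleftrightarrow> (\<forall>y<0. \<forall>\<^sub>F z in at x within X. y < ereal (?q z))"
    unfolding frechet_subdiff_def by (simp add: le_Liminf_iff)
  also have "\<dots> \<longleftrightarrow> (\<forall>e>0. \<forall>\<^sub>F z in at x within X. - e \<le> ?q z)"
  proof (intro iffI allI impI)
    fix e :: real
    assume l: "\<forall>y<0. \<forall>\<^sub>F z in at x within X. y < ereal (?q z)" and "0 < e"
    then have "\<forall>\<^sub>F z in at x within X. ereal (- e) < ereal (?q z)"
      by (intro l[rule_format]) simp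
    then show "\<forall>\<^sub>F z in at x within X. - e \<le> ?q z"
      by (auto elim: eventually_mono)
  next
    fix y :: ereal
    assume r: "\<forall>e>0. \<forall>\<^sub>F z in at x within X. - e \<le> ?q z" and "y < 0"
    then obtain e where e: "0 < e" "y < ereal (- e)"
    proof (cases y)
      case (real s)
      \<comment> \<open>For \<open>y = s < 0\<close> the midpoint \<open>s / 2\<close> of
        \<open>s\<close> and 0 serves as \<open>- e\<close>.\<close>
      then show ?thesis using \<open>y < 0\<close> that[of "- s / 2"] by simp
    next
      case MInf
      then show ?thesis using that[of 1] by simp
    qed auto
    show "\<forall>\<^sub>F z in at x within X. y < ereal (?q z)"
      using r[rule_format, OF e(1)]
      by eventually_elim (use e(2) in \<open>auto elim: less_le_trans\<close>)
  qed
  also have "\<dots> \<longleftrightarrow> (\<forall>e>0. \<forall>\<^sub>F z in at x within X. g x + v \<bullet> (z - x) - e * norm (z - x) \<le> g z)"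
  proof (intro all_cong1 imp_cong refl eventually_cong)
    fix e :: real
    show "\<forall>\<^sub>F z in at x within X. z \<noteq> x" by (rule ne)
  qed (rule q)
  finally show ?thesis .
qed

text \<open>Evaluate the local inequality at \<open>x + t (z - x)\<close> for one small
  \<open>t\<close>, bound the value of \<open>G\<close> there by convexity, and divide by
  \<open>t\<close>: this gives the global inequality up to \<open>e * norm (z - x)\<close>, and
  \<open>e\<close> is arbitrary. The extension \<open>G\<close> is convex on the whole space, so
  neither \<open>X\<close> need be convex nor \<open>z\<close> lie in it.\<close>

lemma frechet_subdiff_convex:
  fixes x :: "'a::real_inner"
  assumes "open X" "x \<in> X" and conv: "convex_on UNIV G" and eq: "\<And>z. z \<in> X \<Longrightarrow> g z = G z"
  shows "frechet_subdiff X g x = {v. \<forall>z. G x + v \<bullet> (z - x) \<le> G z}"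
proof (intro set_eqI iffI CollectI allI)
  fix v z
  assume v: "v \<in> frechet_subdiff X g x"
  have "G x + v \<bullet> (z - x) \<le> G z + e * norm (z - x)" if "0 < e" for e
  proof -
    have "\<forall>\<^sub>F y in at x within X. g x + v \<bullet> (y - x) - e * norm (y - x) \<le> g y"
      using v that mem_frechet_subdiff_iff by blast
    then have "\<forall>\<^sub>F y in at x. g x + v \<bullet> (y - x) - e * norm (y - x) \<le> g y"
      by (simp add: at_within_open[OF assms(2,1)])
    \<comment> \<open>At \<open>y = x\<close> the inequality is an equality, so the punctured filter
      can be replaced by \<open>nhds x\<close> and composed with the ray.\<close>
    then have 1: "\<forall>\<^sub>F y in nhds x. g x + v \<bullet> (y - x) - e * norm (y - x) \<le> g y"
      unfolding eventually_at_filter by (rule eventually_mono) auto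
    have 2: "\<forall>\<^sub>F y in nhds x. y \<in> X"
      using assms(1,2) by (simp add: eventually_nhds_in_open)
    have 3: "((\<lambda>t. x + t *\<^sub>R (z - x)) \<longlongrightarrow> x) (at_right (0::real))"
      by (auto intro!: tendsto_eq_intros)
    have 4: "\<forall>\<^sub>F t in at_right (0::real). t \<in> {0<..<1}"
      by (rule eventually_at_right_real) simp
    have ev: "\<forall>\<^sub>F t in at_right (0::real). t \<in> {0<..<1} \<and> x + t *\<^sub>R (z - x) \<in> X \<and>
        g x + v \<bullet> (t *\<^sub>R (z - x)) - e * norm (t *\<^sub>R (z - x)) \<le> g (x + t *\<^sub>R (z - x))"
      using 4 eventually_compose_filterlim[OF 1 3] eventually_compose_filterlim[OF 2 3]
      by eventually_elim simp
    obtain t :: real where t: "0 < t" "t < 1" "x + t *\<^sub>R (z - x) \<in> X"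
      "g x + v \<bullet> (t *\<^sub>R (z - x)) - e * norm (t *\<^sub>R (z - x)) \<le> g (x + t *\<^sub>R (z - x))"
      using eventually_happens'[OF trivial_limit_at_right_real ev] by auto
    have "G x + t * (v \<bullet> (z - x)) - t * (e * norm (z - x)) \<le> G (x + t *\<^sub>R (z - x))"
      using t eq assms(2) by (simp add: mult.left_commute)
    also have "x + t *\<^sub>R (z - x) = (1 - t) *\<^sub>R x + t *\<^sub>R z"
      by (simp add: algebra_simps)
    also have "G \<dots> \<le> (1 - t) * G x + t * G z"
      using convex_onD[OF conv] t by simp
    finally have "t * (G x + v \<bullet> (z - x)) \<le> t * (G z + e * norm (z - x))"
      by (simp add: algebra_simps)
    then show ?thesis using t by simp
  qed
  note le_add = this
  have *: "G x + v \<bullet> (z - x) \<le> G z + e" if "0 < e" for e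
  proof (cases "z = x")
    case False
    then show ?thesis
      \<comment> \<open>Rescaling by \<open>norm (z - x)\<close> makes the error exactly
        \<open>e\<close>.\<close>
      using le_add[of "e / norm (z - x)"] that by simp
  qed (use that in simp)
  show "G x + v \<bullet> (z - x) \<le> G z"
    by (rule field_le_epsilon) (use * in auto)
next
  fix v assume "v \<in> {v. \<forall>z. G x + v \<bullet> (z - x) \<le> G z}"
  then have "g x + v \<bullet> (z - x) - e * norm (z - x) \<le> g z" if "z \<in> X" "0 < e" for z e
    using that assms(2) eq[of z] eq[of x]
    by (auto dest!: spec[of _ z] intro: order_trans[rotated])
  then show "v \<in> frechet_subdiff X g x"
    unfolding mem_frechet_subdiff_iff by (auto simp: eventually_at_filter)
qed

text \<open>An active \<open>fi i\<close> lies above \<open>f\<close> and touches it at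
  \<open>x\<close>, so it inherits every subgradient of \<open>f\<close>. Conversely, an inactive
  \<open>fi i\<close> is strictly above \<open>f x\<close> at \<open>x\<close> and by continuity
  stays above the tilted minorant nearby; only the active ones constrain \<open>v\<close>.\<close>

lemma frechet_subdiff_Min:
  fixes x :: "'a::real_inner"
  assumes "finite I" "I \<noteq> {}" "x \<in> X"
    and cont: "\<And>i. i \<in> I \<Longrightarrow> (fi i \<longlongrightarrow> fi i x) (at x within X)"
    and f: "\<And>z. z \<in> X \<Longrightarrow> f z = (MIN i\<in>I. fi i z)"
  shows "frechet_subdiff X f x = (\<Inter>i\<in>active I fi f x. frechet_subdiff X (fi i) x)"
proof (intro set_eqI iffI INT_I)
  fix v i assume v: "v \<in> frechet_subdiff X f x" and i: "i \<in> active I fi f x"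
  have "f z \<le> fi i z" if "z \<in> X" for z
    using that i f assms(1) by (auto simp: active_def)
  then have le: "\<forall>\<^sub>F z in at x within X. f z \<le> fi i z"
    by (simp add: eventually_at_filter)
  have "\<forall>\<^sub>F z in at x within X. f x + v \<bullet> (z - x) - e * norm (z - x) \<le> fi i z"
    if "0 < e" for e
  proof -
    have "\<forall>\<^sub>F z in at x within X. f x + v \<bullet> (z - x) - e * norm (z - x) \<le> f z"
      using v that mem_frechet_subdiff_iff by blast
    then show ?thesis
      using le by eventually_elim simp
  qed
  with i show "v \<in> frechet_subdiff X (fi i) x"
    by (simp add: mem_frechet_subdiff_iff active_def)
next
  fix v assume v: "v \<in> (\<Inter>i\<in>active I fi f x. frechet_subdiff X (fi i) x)"
  show "v \<in> frechet_subdiff X f x"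
    unfolding mem_frechet_subdiff_iff
  proof (intro allI impI)
    fix e :: real assume "0 < e"
    let ?l = "\<lambda>z. f x + v \<bullet> (z - x) - e * norm (z - x)"
    have "\<forall>\<^sub>F z in at x within X. ?l z \<le> fi i z" if "i \<in> I" for i
    proof (cases "fi i x = f x")
      case True
      with that v \<open>0 < e\<close> show ?thesis
        by (auto simp: active_def mem_frechet_subdiff_iff)
    next
      case False
      then have "f x < fi i x"
        using f[OF \<open>x \<in> X\<close>] that assms(1) by (simp add: order.not_eq_order_implies_strict)
      moreover have "((\<lambda>z. fi i z - ?l z) \<longlongrightarrow> fi i x - f x) (at x within X)"
        using cont[OF that] by (auto intro!: tendsto_eq_intros)
      ultimately show ?thesis
        using order_tendstoD(1)[of "\<lambda>z. fi i z - ?l z" "fi i x - f x" "at x within X" 0]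
        by (auto elim: eventually_mono)
    qed
    then have "\<forall>\<^sub>F z in at x within X. \<forall>i\<in>I. ?l z \<le> fi i z"
      using assms(1) by (intro eventually_ball_finite) auto
    moreover have "\<forall>\<^sub>F z in at x within X. z \<in> X"
      by (simp add: eventually_at_filter)
    ultimately show "\<forall>\<^sub>F z in at x within X. ?l z \<le> f z"
      by eventually_elim (use assms(1,2) f in auto)
  qed
qed

section \<open>Maxima of finitely many affine functions\<close>

definition max_affine :: "'j set \<Rightarrow> ('j \<Rightarrow> 'a::real_inner) \<Rightarrow> ('j \<Rightarrow> real) \<Rightarrow> 'a \<Rightarrow> real" where
  "max_affine J a b x = (MAX j\<in>J. a j \<bullet> x + b j)"

definition tight :: "'j set \<Rightarrow> ('j \<Rightarrow> 'a::real_inner) \<Rightarrow> ('j \<Rightarrow> real) \<Rightarrow> 'a \<Rightarrow> 'j set" where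
  "tight J a b x = {j \<in> J. a j \<bullet> x + b j = max_affine J a b x}"

text \<open>The support function of the finite set of vectors \<open>a j\<close>, \<open>j\<close>
  in \<open>T\<close>. With \<open>T = tight J a b x\<close> it is the directional derivative of
  \<open>max_affine J a b\<close> at \<open>x\<close>.\<close>

definition max_linear :: "'j set \<Rightarrow> ('j \<Rightarrow> 'a::real_inner) \<Rightarrow> 'a \<Rightarrow> real" where
  "max_linear T a h = (MAX j\<in>T. a j \<bullet> h)"

lemma finite_tight: "finite J \<Longrightarrow> finite (tight J a b x)"
  by (simp add: tight_def)

lemma tight_nonempty:
  assumes "finite J" "J \<noteq> {}"
  shows "tight J a b x \<noteq> {}"
proof -
  have "max_affine J a b x \<in> (\<lambda>j. a j \<bullet> x + b j) ` J"
    unfolding max_affine_def using assms by (intro Max_in) auto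
  then show ?thesis by (force simp: tight_def)
qed

lemma tendsto_max_affine:
  assumes "finite J" "J \<noteq> {}"
  shows "(max_affine J a b \<longlongrightarrow> max_affine J a b x) (nhds x)"
  unfolding max_affine_def[abs_def] using assms
  by (intro tendsto_Max_image) (auto intro!: tendsto_intros filterlim_ident)

lemma tendsto_max_linear:
  assumes "finite T" "T \<noteq> {}"
  shows "(max_linear T a \<longlongrightarrow> max_linear T a h) (nhds h)"
  unfolding max_linear_def[abs_def] using assms
  by (intro tendsto_Max_image) (auto intro!: tendsto_intros filterlim_ident)

lemma max_linear_scaleR:
  assumes "finite T" "T \<noteq> {}" "0 \<le> t"
  shows "max_linear T a (t *\<^sub>R h) = t * max_linear T a h"
proof -
  have "mono ((*) t)"
    using assms by (auto intro!: monoI mult_left_mono)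
  from mono_Max_commute[OF this, of "(\<lambda>j. a j \<bullet> h) ` T"] show ?thesis
    using assms by (simp add: max_linear_def image_image)
qed

lemma convex_on_max_affine:
  assumes "finite J" "J \<noteq> {}"
  shows "convex_on UNIV (max_affine J a b)"
proof (rule convex_onI)
  fix t x y assume t: "0 < t" "t < (1::real)"
  have "a j \<bullet> ((1 - t) *\<^sub>R x + t *\<^sub>R y) + b j \<le> (1 - t) * max_affine J a b x + t * max_affine J a b y"
    if "j \<in> J" for j
  proof -
    have le: "a j \<bullet> z + b j \<le> max_affine J a b z" for z
      using that assms by (auto simp: max_affine_def)
    have "a j \<bullet> ((1 - t) *\<^sub>R x + t *\<^sub>R y) + b j = (1 - t) * (a j \<bullet> x + b j) + t * (a j \<bullet> y + b j)"
      by (simp add: algebra_simps)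
    also have "\<dots> \<le> (1 - t) * max_affine J a b x + t * max_affine J a b y"
      using t by (intro add_mono mult_left_mono le) auto
    finally show ?thesis .
  qed
  then show "max_affine J a b ((1 - t) *\<^sub>R x + t *\<^sub>R y)
      \<le> (1 - t) * max_affine J a b x + t * max_affine J a b y"
    using assms unfolding max_affine_def[of J a b "_ + _"] by auto
qed simp

lemma max_affine_ge_tangent:
  assumes "finite J" "j \<in> tight J a b x"
  shows "max_affine J a b x + a j \<bullet> (z - x) \<le> max_affine J a b z"
proof -
  have "a j \<bullet> z + b j \<le> max_affine J a b z"
    using assms by (auto simp: max_affine_def tight_def)
  then show ?thesis
    using assms by (auto simp: tight_def inner_diff_right)
qed

text \<open>Pieces strictly below the maximum at \<open>x\<close> stay below near \<open>x\<close>,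
  so only tight pieces compete, and these share their value at \<open>x\<close>. The expansion is
  therefore exact, with no remainder term.\<close>

lemma max_affine_local:
  assumes "finite J" "J \<noteq> {}"
  shows "\<forall>\<^sub>F z in nhds x. max_affine J a b z = max_affine J a b x + max_linear (tight J a b x) a (z - x)"
proof -
  let ?g = "\<lambda>j z. a j \<bullet> z + b j"
  let ?T = "tight J a b x"
  have "\<forall>\<^sub>F z in nhds x. \<forall>i\<in>J. \<forall>j\<in>J. ?g i x < ?g j x \<longrightarrow> ?g i z < ?g j z"
    using assms by (intro strict_order_persists) (auto intro!: tendsto_intros filterlim_ident)
  then show ?thesis
  proof eventually_elim
    case (elim z)
    have "max_affine J a b z = (MAX j\<in>?T. ?g j z)"
      using Max_image_maximizers[OF assms elim] by (simp add: max_affine_def tight_def)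
    also have "\<dots> = (MAX j\<in>?T. a j \<bullet> (z - x) + max_affine J a b x)"
      by (intro arg_cong[where f = Max] image_cong refl) (auto simp: tight_def inner_diff_right)
    also have "\<dots> = (MAX j\<in>?T. a j \<bullet> (z - x)) + max_affine J a b x"
      using assms by (intro Max_add_commute finite_tight tight_nonempty)
    finally show ?case
      by (simp add: max_linear_def)
  qed
qed

lemma eventually_nhds_ray:
  fixes x p :: "'a::real_normed_vector"
  assumes "\<forall>\<^sub>F z in nhds x. P z"
  shows "\<forall>\<^sub>F t in at_right (0::real). P (x + t *\<^sub>R p)"
  by (rule eventually_compose_filterlim[OF assms]) (auto intro!: tendsto_eq_intros)

text \<open>Forward: apply the exact local expansion on a short ray in direction \<open>h\<close>
  and cancel \<open>t\<close> by homogeneity. Backward: every tight piece is a global affine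
  minorant, so the linearization at \<open>x\<close> bounds the function from below
  everywhere.\<close>

lemma max_affine_subgradient_iff:
  assumes "finite J" "J \<noteq> {}"
  shows "(\<forall>z. max_affine J a b x + v \<bullet> (z - x) \<le> max_affine J a b z) \<longleftrightarrow>
    (\<forall>h. v \<bullet> h \<le> max_linear (tight J a b x) a h)"
proof (intro iffI allI)
  fix h assume l: "\<forall>z. max_affine J a b x + v \<bullet> (z - x) \<le> max_affine J a b z"
  have ev: "\<forall>\<^sub>F t in at_right (0::real). 0 < t \<and>
      max_affine J a b (x + t *\<^sub>R h) = max_affine J a b x + max_linear (tight J a b x) a (t *\<^sub>R h)"
    using eventually_nhds_ray[OF max_affine_local[OF assms], where p = h] eventually_at_right_less
    by eventually_elim simp
  obtain t :: real where t: "0 < t"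
      "max_affine J a b (x + t *\<^sub>R h) = max_affine J a b x + max_linear (tight J a b x) a (t *\<^sub>R h)"
    using eventually_happens'[OF trivial_limit_at_right_real ev] by auto
  then have "t * (v \<bullet> h) \<le> t * max_linear (tight J a b x) a h"
    using l[rule_format, of "x + t *\<^sub>R h"] assms
    by (simp add: max_linear_scaleR finite_tight tight_nonempty)
  then show "v \<bullet> h \<le> max_linear (tight J a b x) a h"
    using t by simp
next
  fix z assume r: "\<forall>h. v \<bullet> h \<le> max_linear (tight J a b x) a h"
  have "max_linear (tight J a b x) a (z - x) \<le> max_affine J a b z - max_affine J a b x"
    unfolding max_linear_def using assms max_affine_ge_tangent[of J _ a b x z]
    by (subst Max_le_iff) (auto simp: finite_tight tight_nonempty algebra_simps)
  then show "max_affine J a b x + v \<bullet> (z - x) \<le> max_affine J a b z"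
    using r[rule_format, of "z - x"] by simp
qed

section \<open>Minima of maxima of affine functions\<close>

locale min_max_affine =
  fixes X :: "'a::real_inner set" and I :: "'i set" and J :: "'i \<Rightarrow> 'j set"
    and a :: "'i \<Rightarrow> 'j \<Rightarrow> 'a" and b :: "'i \<Rightarrow> 'j \<Rightarrow> real"
    and fi :: "'i \<Rightarrow> 'a \<Rightarrow> real" and f :: "'a \<Rightarrow> real"
  assumes open_X: "open X"
    and finite_I: "finite I" and I_nonempty: "I \<noteq> {}"
    and finite_J: "\<And>i. i \<in> I \<Longrightarrow> finite (J i)" and J_nonempty: "\<And>i. i \<in> I \<Longrightarrow> J i \<noteq> {}"
    and fi_eq: "\<And>i x. i \<in> I \<Longrightarrow> x \<in> X \<Longrightarrow> fi i x = max_affine (J i) (a i) (b i) x"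
    and f_eq: "\<And>x. x \<in> X \<Longrightarrow> f x = (MIN i\<in>I. fi i x)"
begin

section \<open>Directional slopes of the pieces and of their minimum\<close>

definition slope :: "'a \<Rightarrow> 'i \<Rightarrow> 'a \<Rightarrow> real" where
  "slope x i = max_linear (tight (J i) (a i) (b i) x) (a i)"

text \<open>\<open>slope x i\<close> will be the support function of the subdifferential of
  \<open>fi i\<close> at \<open>x\<close>, and \<open>min_slope x\<close> the Hadamard derivative of
  \<open>f\<close> at \<open>x\<close>, for \<open>i\<close> in \<open>I\<close> and
  \<open>x\<close> in \<open>X\<close>.\<close>

definition min_slope :: "'a \<Rightarrow> 'a \<Rightarrow> real" where
  "min_slope x p = (MIN i\<in>active I fi f x. slope x i p)"

lemma active_subset: "active I fi f x \<subseteq> I"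
  by (auto simp: active_def)

lemma finite_active: "finite (active I fi f x)"
  using finite_I active_subset finite_subset by blast

lemma active_nonempty:
  assumes "x \<in> X"
  shows "active I fi f x \<noteq> {}"
proof -
  have "f x \<in> (\<lambda>i. fi i x) ` I"
    unfolding f_eq[OF assms] using finite_I I_nonempty by (intro Min_in) auto
  then show ?thesis by (force simp: active_def)
qed

lemma slope_scaleR: "i \<in> I \<Longrightarrow> 0 \<le> t \<Longrightarrow> slope x i (t *\<^sub>R p) = t * slope x i p"
  unfolding slope_def
  by (intro max_linear_scaleR finite_tight tight_nonempty finite_J J_nonempty)

lemma min_slope_scaleR:
  assumes "x \<in> X" "0 \<le> t"
  shows "min_slope x (t *\<^sub>R p) = t * min_slope x p"
proof -
  have "mono ((*) t)"
    using assms by (auto intro!: monoI mult_left_mono)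
  from mono_Min_commute[OF this, of "(\<lambda>i. slope x i p) ` active I fi f x"]
  have "t * min_slope x p = (MIN i\<in>active I fi f x. t * slope x i p)"
    using finite_active active_nonempty[OF assms(1)] by (simp add: min_slope_def image_image)
  also have "\<dots> = min_slope x (t *\<^sub>R p)"
    unfolding min_slope_def using assms(2) active_subset
    by (intro arg_cong[where f = Min] image_cong refl) (auto simp: slope_scaleR subset_iff)
  finally show ?thesis ..
qed

lemma tendsto_min_slope:
  assumes "x \<in> X"
  shows "(min_slope x \<longlongrightarrow> min_slope x p) (nhds p)"
  unfolding min_slope_def[abs_def] slope_def
  using finite_active active_nonempty[OF assms] active_subset[of x]
  by (intro tendsto_Min_image tendsto_max_linear finite_tight tight_nonempty finite_J J_nonempty) auto

section \<open>Subdifferentials of the pieces and of the minimum\<close>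

lemma frechet_subdiff_fi:
  assumes "i \<in> I" "x \<in> X"
  shows "frechet_subdiff X (fi i) x =
    {v. \<forall>z. max_affine (J i) (a i) (b i) x + v \<bullet> (z - x) \<le> max_affine (J i) (a i) (b i) z}"
  using assms open_X finite_J J_nonempty fi_eq
  by (intro frechet_subdiff_convex convex_on_max_affine) auto

text \<open>This form is an intersection of half-spaces determined by the tight pieces alone, which
  later yields closedness and finiteness.\<close>

lemma frechet_subdiff_fi_slope:
  assumes "i \<in> I" "x \<in> X"
  shows "frechet_subdiff X (fi i) x = {v. \<forall>h. v \<bullet> h \<le> slope x i h}"
  unfolding frechet_subdiff_fi[OF assms] slope_def
  by (simp add: max_affine_subgradient_iff finite_J J_nonempty assms(1))

lemma frechet_subdiff_f:
  assumes "x \<in> X"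
  shows "frechet_subdiff X f x = (\<Inter>i\<in>active I fi f x. frechet_subdiff X (fi i) x)"
proof (rule frechet_subdiff_Min[OF finite_I I_nonempty assms])
  fix i assume i: "i \<in> I"
  have "(max_affine (J i) (a i) (b i) \<longlongrightarrow> max_affine (J i) (a i) (b i) x) (at x within X)"
    using tendsto_max_affine[OF finite_J[OF i] J_nonempty[OF i]]
    by (rule filterlim_mono) (auto simp: at_within_def)
  moreover have "\<forall>\<^sub>F z in at x within X. max_affine (J i) (a i) (b i) z = fi i z"
    using fi_eq[OF i] by (simp add: eventually_at_filter)
  ultimately show "(fi i \<longlongrightarrow> fi i x) (at x within X)"
    using fi_eq[OF i assms] by (simp add: tendsto_cong)
qed (rule f_eq)

text \<open>Subgradients satisfy \<open>v \<bullet> p \<le> slope x i p\<close>, and equality is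
  reached by the gradient \<open>a i j\<close> of a tight piece steepest in direction
  \<open>p\<close>.\<close>

lemma max_value_Argmax_fi:
  assumes i: "i \<in> I" and x: "x \<in> X"
  shows "max_value (\<lambda>v. v \<bullet> p) (frechet_subdiff X (fi i) x) = slope x i p"
    and "Argmax (\<lambda>v. v \<bullet> p) (frechet_subdiff X (fi i) x) =
      {v \<in> frechet_subdiff X (fi i) x. v \<bullet> p = slope x i p}"
proof -
  let ?T = "tight (J i) (a i) (b i) x"
  have "slope x i p \<in> (\<lambda>j. a i j \<bullet> p) ` ?T"
    unfolding slope_def max_linear_def
    by (intro Max_in) (simp_all add: finite_tight tight_nonempty finite_J J_nonempty i)
  then obtain j where j: "j \<in> ?T" "a i j \<bullet> p = slope x i p"
    by force
  have mem: "a i j \<in> frechet_subdiff X (fi i) x"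
    using max_affine_ge_tangent[OF finite_J[OF i] j(1)] by (simp add: frechet_subdiff_fi[OF i x])
  have le: "\<And>v. v \<in> frechet_subdiff X (fi i) x \<Longrightarrow> v \<bullet> p \<le> slope x i p"
    by (simp add: frechet_subdiff_fi_slope[OF i x])
  show "max_value (\<lambda>v. v \<bullet> p) (frechet_subdiff X (fi i) x) = slope x i p"
    by (rule max_value_Argmax_eqI(1)[where h = "\<lambda>v. v \<bullet> p", OF mem j(2) le])
  show "Argmax (\<lambda>v. v \<bullet> p) (frechet_subdiff X (fi i) x) =
      {v \<in> frechet_subdiff X (fi i) x. v \<bullet> p = slope x i p}"
    by (rule max_value_Argmax_eqI(2)[where h = "\<lambda>v. v \<bullet> p", OF mem j(2) le])
qed

lemma active_dir_eq:
  assumes "x \<in> X"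
  shows "active_dir X I fi f x p = {i \<in> active I fi f x. slope x i p = min_slope x p}"
proof -
  have eq: "max_value (\<lambda>v. v \<bullet> p) (frechet_subdiff X (fi i) x) = slope x i p"
    if "i \<in> active I fi f x" for i
    using that assms active_subset by (intro max_value_Argmax_fi) auto
  then have "(MIN i\<in>active I fi f x. max_value (\<lambda>v. v \<bullet> p) (frechet_subdiff X (fi i) x)) = min_slope x p"
    unfolding min_slope_def by (intro arg_cong[where f = Min] image_cong refl)
  then show ?thesis
    using eq by (auto simp: active_dir_def)
qed

section \<open>Exact local form of \<open>f\<close>, its Hadamard derivative and nearby
  subdifferentials\<close>

lemma f_local:
  assumes x: "x \<in> X"
  shows "\<forall>\<^sub>F z in nhds x. z \<in> X \<and> (\<forall>i\<in>I. fi i z = fi i x + slope x i (z - x)) \<and>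
    f z = f x + min_slope x (z - x) \<and> active I fi f z \<subseteq> active I fi f x"
proof -
  let ?G = "\<lambda>i. max_affine (J i) (a i) (b i)"
  let ?A = "active I fi f x"
  have 1: "\<forall>\<^sub>F z in nhds x. \<forall>i\<in>I. \<forall>j\<in>I. ?G i x < ?G j x \<longrightarrow> ?G i z < ?G j z"
    using finite_I finite_J J_nonempty by (intro strict_order_persists tendsto_max_affine) auto
  have 2: "\<forall>\<^sub>F z in nhds x. \<forall>i\<in>I. ?G i z = ?G i x + slope x i (z - x)"
    unfolding slope_def using finite_I finite_J J_nonempty
    by (intro eventually_ball_finite ballI max_affine_local) auto
  have 3: "\<forall>\<^sub>F z in nhds x. z \<in> X"
    using x open_X by (simp add: eventually_nhds_in_open)
  from 1 2 3 show ?thesis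
  proof eventually_elim
    case (elim z)
    have ord: "\<forall>i\<in>I. \<forall>j\<in>I. fi i x < fi j x \<longrightarrow> fi i z < fi j z"
      using elim fi_eq x by simp
    have fi: "\<forall>i\<in>I. fi i z = fi i x + slope x i (z - x)"
      using elim fi_eq x by simp
    have "f z = (MIN i\<in>?A. fi i z)"
      using Min_image_minimizers[OF finite_I I_nonempty ord] f_eq x elim(3)
      by (simp add: active_def)
    also have "\<dots> = (MIN i\<in>?A. slope x i (z - x) + f x)"
      using fi by (intro arg_cong[where f = Min] image_cong refl) (auto simp: active_def)
    also have "\<dots> = min_slope x (z - x) + f x"
      unfolding min_slope_def by (intro Min_add_commute finite_active active_nonempty x)
    finally have f: "f z = f x + min_slope x (z - x)" by simp
    \<comment> \<open>A piece inactive at \<open>x\<close> is strictly above some active piece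
      \<open>k\<close> there, hence also at \<open>z\<close>, so it cannot attain the minimum at
      \<open>z\<close>.\<close>
    have "j \<in> ?A" if j: "j \<in> active I fi f z" for j
    proof (rule ccontr)
      assume "j \<notin> ?A"
      with j have jI: "j \<in> I" "fi j x \<noteq> f x" by (auto simp: active_def)
      then have "f x < fi j x"
        using f_eq[OF x] finite_I by (simp add: order.not_eq_order_implies_strict)
      moreover obtain k where k: "k \<in> I" "fi k x = f x"
        using active_nonempty[OF x] by (auto simp: active_def)
      ultimately have "fi k z < fi j z"
        using ord jI by simp
      moreover have "f z \<le> fi k z"
        using f_eq elim(3) finite_I k by simp
      ultimately show False
        using j by (simp add: active_def)
    qed
    with f fi elim(3) show ?case by blast
  qed
qed

text \<open>By the exact local form and homogeneity, the quotient eventually equals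
  \<open>min_slope x p'\<close>; continuity of \<open>min_slope x\<close> gives the limit.\<close>

lemma hadamard_deriv_f:
  assumes x: "x \<in> X"
  shows "hadamard_deriv X f x p = min_slope x p"
proof -
  let ?F = "at_right (0::real) \<times>\<^sub>F nhds p"
  let ?F' = "inf ?F (principal {(t, p'). x + t *\<^sub>R p' \<in> X})"
  let ?q = "\<lambda>(t, p'). (f (x + t *\<^sub>R p') - f x) / t"
  have fst: "(fst \<longlongrightarrow> 0) ?F"
    using filterlim_fst[of "at_right (0::real)" "nhds p"]
    by (rule filterlim_mono) (auto simp: at_within_def)
  have "((\<lambda>y. x + fst y *\<^sub>R snd y) \<longlongrightarrow> x + 0 *\<^sub>R p) ?F"
    by (intro tendsto_intros fst filterlim_snd)
  then have lim: "((\<lambda>y. x + fst y *\<^sub>R snd y) \<longlongrightarrow> x) ?F"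
    by simp
  have pos: "\<forall>\<^sub>F y in ?F. 0 < fst y"
    using eventually_compose_filterlim[OF eventually_at_right_less filterlim_fst] .
  have ev: "\<forall>\<^sub>F y in ?F. x + fst y *\<^sub>R snd y \<in> X \<and> ?q y = min_slope x (snd y)"
    using pos eventually_compose_filterlim[OF f_local[OF x] lim]
  proof eventually_elim
    case (elim y)
    then show ?case
      using min_slope_scaleR[OF x, of "fst y" "snd y"] by (auto simp: case_prod_beta)
  qed
  \<comment> \<open>As \<open>X\<close> is open, the points considered eventually lie in
    \<open>X\<close>, so the domain restriction leaves the filter unchanged.\<close>
  have F: "?F' = ?F"
  proof (rule inf_absorb1)
    show "?F \<le> principal {(t, p'). x + t *\<^sub>R p' \<in> X}"
      unfolding le_principal using ev by eventually_elim (simp add: case_prod_beta)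
  qed
  have "((\<lambda>y. min_slope x (snd y)) \<longlongrightarrow> min_slope x p) ?F"
    by (rule filterlim_compose[OF tendsto_min_slope[OF x] filterlim_snd])
  moreover have "\<forall>\<^sub>F y in ?F. min_slope x (snd y) = ?q y"
    using ev by eventually_elim simp
  ultimately have "(?q \<longlongrightarrow> min_slope x p) ?F"
    by (rule Lim_transform_eventually)
  moreover have "?F \<noteq> bot"
    by (simp add: prod_filter_eq_bot)
  ultimately show ?thesis
    unfolding hadamard_deriv_def F by (intro tendsto_Lim) auto
qed

text \<open>Along a short segment leaving \<open>x\<close> in direction \<open>p\<close>, each active \<open>fi i\<close> is affine.
  Testing the subgradient inequality at both \<open>x\<close> and \<open>x + 2 t p\<close> forces \<open>v \<bullet> p = slope x i p\<close>.\<close>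

lemma frechet_subdiff_f_near:
  assumes x: "x \<in> X"
  obtains d where "0 < d" and
    "\<And>p t. norm p = 1 \<Longrightarrow> 0 < t \<Longrightarrow> t < d \<Longrightarrow>
      x + t *\<^sub>R p \<in> X \<and> f (x + t *\<^sub>R p) = f x + t * min_slope x p \<and>
      frechet_subdiff X f (x + t *\<^sub>R p) =
        (\<Inter>i\<in>active_dir X I fi f x p. Argmax (\<lambda>v. v \<bullet> p) (frechet_subdiff X (fi i) x))"
proof -
  obtain d where d: "0 < d" and
    near: "\<And>z. dist z x < d \<Longrightarrow> z \<in> X \<and> (\<forall>i\<in>I. fi i z = fi i x + slope x i (z - x)) \<and>
      f z = f x + min_slope x (z - x) \<and> active I fi f z \<subseteq> active I fi f x"
    using f_local[OF x] unfolding eventually_nhds_metric by blast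
  \<comment> \<open>Halving \<open>d\<close> keeps the test point \<open>x + 2 t p\<close> inside
    the neighbourhood where the local form holds.\<close>
  show ?thesis
  proof (rule that[of "d / 2"])
    show "0 < d / 2" using d by simp
    fix p :: 'a and t :: real
    assume p: "norm p = 1" and t: "0 < t" "t < d / 2"
    define y where "y = x + t *\<^sub>R p"
    have yX: "y \<in> X" and fiy: "\<And>i. i \<in> I \<Longrightarrow> fi i y = fi i x + t * slope x i p"
      and fy: "f y = f x + t * min_slope x p" and act: "active I fi f y \<subseteq> active I fi f x"
      using near[of y] p t min_slope_scaleR[OF x, of t p] slope_scaleR[of _ t x p]
      by (auto simp: y_def dist_norm)
    define y2 where "y2 = x + (2 * t) *\<^sub>R p"
    have y2X: "y2 \<in> X" and fiy2: "\<And>i. i \<in> I \<Longrightarrow> fi i y2 = fi i x + 2 * t * slope x i p"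
      using near[of y2] p t slope_scaleR[of _ "2 * t" x p]
      by (auto simp: y2_def dist_norm)
    have sub: "frechet_subdiff X (fi i) y = Argmax (\<lambda>v. v \<bullet> p) (frechet_subdiff X (fi i) x)"
      if i: "i \<in> I" for i
    proof -
      let ?G = "max_affine (J i) (a i) (b i)"
      have Gy: "?G y = ?G x + t * slope x i p" and Gy2: "?G y2 = ?G x + 2 * t * slope x i p"
        using fiy[OF i] fiy2[OF i] fi_eq[OF i] x yX y2X by auto
      have "(\<forall>z. ?G y + v \<bullet> (z - y) \<le> ?G z) \<longleftrightarrow>
          (\<forall>z. ?G x + v \<bullet> (z - x) \<le> ?G z) \<and> v \<bullet> p = slope x i p" for v
      proof -
        \<comment> \<open>The affine minorants anchored at \<open>y\<close> and at \<open>x\<close>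
          differ by the constant \<open>t * (slope x i p - v \<bullet> p)\<close>, so they coincide
          once \<open>v \<bullet> p = slope x i p\<close>.\<close>
        have shift: "?G y + v \<bullet> (z - y) = ?G x + v \<bullet> (z - x) + t * (slope x i p - v \<bullet> p)" for z
          unfolding Gy by (simp add: y_def algebra_simps)
        have "v \<bullet> p = slope x i p" if l: "\<forall>z. ?G y + v \<bullet> (z - y) \<le> ?G z"
        proof (rule antisym)
          have "t * (v \<bullet> p) \<le> t * slope x i p"
            using l[rule_format, of y2] unfolding shift Gy2 by (simp add: y2_def algebra_simps)
          then show "v \<bullet> p \<le> slope x i p" using t by simp
          have "t * slope x i p \<le> t * (v \<bullet> p)"
            using l[rule_format, of x] unfolding shift by (simp add: algebra_simps)
          then show "slope x i p \<le> v \<bullet> p" using t by simp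
        qed
        then show ?thesis
          unfolding shift by fastforce
      qed
      then show ?thesis
        unfolding max_value_Argmax_fi(2)[OF i x] unfolding frechet_subdiff_fi[OF i x] frechet_subdiff_fi[OF i yX]
        by blast
    qed
    \<comment> \<open>Indices active at \<open>y\<close> are active at \<open>x\<close>. Those start
      from the common value \<open>f x\<close>, so they are minimal at \<open>y\<close> exactly when
      their slope along \<open>p\<close> is minimal.\<close>
    have "active I fi f y = active_dir X I fi f x p"
      unfolding active_dir_eq[OF x] using act fiy fy t by (auto simp: active_def)
    then have "frechet_subdiff X f y =
        (\<Inter>i\<in>active_dir X I fi f x p. Argmax (\<lambda>v. v \<bullet> p) (frechet_subdiff X (fi i) x))"
      unfolding frechet_subdiff_f[OF yX] using sub active_subset[of y]
      by (intro INF_cong) (auto simp: subset_iff)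
    with yX fy show "x + t *\<^sub>R p \<in> X \<and> f (x + t *\<^sub>R p) = f x + t * min_slope x p \<and>
      frechet_subdiff X f (x + t *\<^sub>R p) =
        (\<Inter>i\<in>active_dir X I fi f x p. Argmax (\<lambda>v. v \<bullet> p) (frechet_subdiff X (fi i) x))"
      by (simp add: y_def)
  qed
qed

section \<open>Closed subdifferentials, finite in number, and the outer limit\<close>

lemma closed_frechet_subdiff_f:
  assumes "x \<in> X"
  shows "closed (frechet_subdiff X f x)"
proof -
  have "closed {v. \<forall>h. v \<bullet> h \<le> slope x i h}" for i
    by (intro closed_Collect_all closed_Collect_le continuous_intros)
  then show ?thesis
    unfolding frechet_subdiff_f[OF assms] using frechet_subdiff_fi_slope[OF _ assms] active_subset
    by (intro closed_INT ballI) (auto simp: subset_iff)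
qed

text \<open>The subdifferential at \<open>x\<close> only depends on which \<open>fi i\<close> and which of their affine pieces
  are active at \<open>x\<close>.\<close>

lemma finite_frechet_subdiffs: "finite (frechet_subdiff X f ` X)"
proof -
  \<comment> \<open>\<open>T x\<close> records the active pairs of piece and tight affine function;
    \<open>\<Phi>\<close> rebuilds the subdifferential from it. Nonempty tight sets ensure that
    \<open>fst\<close> recovers every active index.\<close>
  define T where "T x = Sigma (active I fi f x) (\<lambda>i. tight (J i) (a i) (b i) x)" for x
  define \<Phi> where "\<Phi> S = {v. \<forall>i\<in>fst ` S. \<forall>h. v \<bullet> h \<le> max_linear (S `` {i}) (a i) h}" for S
  have "frechet_subdiff X f x = \<Phi> (T x)" if x: "x \<in> X" for x
  proof -
    have "tight (J i) (a i) (b i) x \<noteq> {}" if "i \<in> active I fi f x" for i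
      using that active_subset by (intro tight_nonempty finite_J J_nonempty) auto
    then have "fst ` T x = active I fi f x"
      by (auto simp: T_def fst_image_Sigma)
    moreover have "T x `` {i} = tight (J i) (a i) (b i) x" if "i \<in> active I fi f x" for i
      using that by (auto simp: T_def)
    moreover have "frechet_subdiff X f x = {v. \<forall>i\<in>active I fi f x. \<forall>h. v \<bullet> h \<le> slope x i h}"
      unfolding frechet_subdiff_f[OF x] using frechet_subdiff_fi_slope[OF _ x] active_subset[of x]
      by auto
    ultimately show ?thesis
      by (auto simp: \<Phi>_def slope_def)
  qed
  then have "frechet_subdiff X f ` X \<subseteq> \<Phi> ` Pow (Sigma I J)"
    by (auto simp: T_def active_def tight_def)
  then show ?thesis
    by (rule finite_subset) (use finite_I finite_J in auto)
qed

text \<open>Since only finitely many closed sets occur as subdifferentials, one of them contains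
  a whole subsequence and hence its limit.\<close>

lemma outer_limit_subdiff_attained:
  assumes "v \<in> outer_limit_subdiff X f x" "0 < d"
  obtains y where "y \<in> X" "f x < f y" "dist y x < d" "v \<in> frechet_subdiff X f y"
proof -
  obtain xs vs where s: "\<And>k::nat. xs k \<in> X" "\<And>k. f x < f (xs k)"
      "\<And>k. vs k \<in> frechet_subdiff X f (xs k)" and lim: "xs \<longlonglongrightarrow> x" "vs \<longlonglongrightarrow> v"
    using assms(1) unfolding outer_limit_subdiff_def by blast
  have "finite (range (\<lambda>k. frechet_subdiff X f (xs k)))"
    by (rule finite_subset[OF _ finite_frechet_subdiffs]) (use s in auto)
  then obtain k0 where inf: "infinite {k. frechet_subdiff X f (xs k) = frechet_subdiff X f (xs k0)}"
    using pigeonhole_infinite[of UNIV "\<lambda>k. frechet_subdiff X f (xs k)"] by auto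
  define r where "r = enumerate {k. frechet_subdiff X f (xs k) = frechet_subdiff X f (xs k0)}"
  have r: "strict_mono r" "\<And>n. frechet_subdiff X f (xs (r n)) = frechet_subdiff X f (xs k0)"
    using strict_mono_enumerate[OF inf] enumerate_in_set[OF inf] by (auto simp: r_def)
  have v: "v \<in> frechet_subdiff X f (xs k0)"
  proof (rule closed_sequentially[OF closed_frechet_subdiff_f[OF s(1)]])
    show "(vs \<circ> r) n \<in> frechet_subdiff X f (xs k0)" for n
      using s(3)[of "r n"] r(2)[of n] by simp
    show "(vs \<circ> r) \<longlonglongrightarrow> v"
      by (rule LIMSEQ_subseq_LIMSEQ[OF lim(2) r(1)])
  qed
  have "(xs \<circ> r) \<longlonglongrightarrow> x"
    by (rule LIMSEQ_subseq_LIMSEQ[OF lim(1) r(1)])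
  \<comment> \<open>The witness is \<open>xs (r n)\<close> for a suitable \<open>n\<close>:
    \<open>xs k0\<close> has the same subdifferential but need not be close to
    \<open>x\<close>.\<close>
  then obtain n where "dist (xs (r n)) x < d"
    using \<open>0 < d\<close> unfolding lim_sequentially by fastforce
  then show ?thesis
    using that[of "xs (r n)"] s v r(2)[of n] by simp
qed

text \<open>On a small ball, directions and points correspond through \<open>y = x + t p\<close>. A
  vector on the left is a subgradient all along a ray shrinking to \<open>x\<close>; one on the
  right is attained at some \<open>y\<close> in the ball, whose direction from \<open>x\<close> is
  the required \<open>p\<close>.\<close>

lemma union_Argmax_eq_outer_limit:
  assumes x: "x \<in> X"
  shows "(\<Union>p\<in>{p \<in> sphere 0 1. hadamard_deriv X f x p > 0}.
            \<Inter>i\<in>active_dir X I fi f x p. Argmax (\<lambda>v. v \<bullet> p) (frechet_subdiff X (fi i) x))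
         = outer_limit_subdiff X f x" (is "?L = _")
proof (intro set_eqI iffI)
  obtain d where d: "0 < d" and near: "\<And>p t. norm p = 1 \<Longrightarrow> 0 < t \<Longrightarrow> t < d \<Longrightarrow>
      x + t *\<^sub>R p \<in> X \<and> f (x + t *\<^sub>R p) = f x + t * min_slope x p \<and>
      frechet_subdiff X f (x + t *\<^sub>R p) =
        (\<Inter>i\<in>active_dir X I fi f x p. Argmax (\<lambda>v. v \<bullet> p) (frechet_subdiff X (fi i) x))"
    using frechet_subdiff_f_near[OF x] by blast
  {
    fix v assume "v \<in> ?L"
    then obtain p where p: "norm p = 1" "0 < min_slope x p" and
      v: "v \<in> (\<Inter>i\<in>active_dir X I fi f x p. Argmax (\<lambda>v. v \<bullet> p) (frechet_subdiff X (fi i) x))"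
      by (auto simp: hadamard_deriv_f[OF x])
    \<comment> \<open>The factor \<open>d / 2\<close> keeps every \<open>t k\<close> strictly below
      \<open>d\<close>, including at \<open>k = 0\<close>.\<close>
    define t where "t k = d / 2 * inverse (real (Suc k))" for k
    have t: "0 < t k" "t k < d" for k
    proof -
      have "inverse (real (Suc k)) \<le> 1"
        by (simp add: field_simps)
      then have "t k \<le> d / 2 * 1"
        unfolding t_def using d by (intro mult_left_mono) auto
      then show "t k < d" using d by simp
    qed (use d in \<open>simp add: t_def\<close>)
    have "t \<longlonglongrightarrow> 0"
      unfolding t_def using tendsto_mult_right_zero[OF LIMSEQ_inverse_real_of_nat] .
    then have "(\<lambda>k. x + t k *\<^sub>R p) \<longlonglongrightarrow> x"
      by (auto intro!: tendsto_eq_intros)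
    moreover have "x + t k *\<^sub>R p \<in> X \<and> f x < f (x + t k *\<^sub>R p) \<and>
        v \<in> frechet_subdiff X f (x + t k *\<^sub>R p)" for k
      using near[OF p(1) t] v p(2) t(1) by simp
    ultimately show "v \<in> outer_limit_subdiff X f x"
      unfolding outer_limit_subdiff_def
      by (intro CollectI exI[of _ "\<lambda>k. x + t k *\<^sub>R p"] exI[of _ "\<lambda>_. v"]) simp
  next
    fix v assume "v \<in> outer_limit_subdiff X f x"
    then obtain y where y: "f x < f y" "dist y x < d" "v \<in> frechet_subdiff X f y"
      using outer_limit_subdiff_attained d by blast
    define t where "t = norm (y - x)"
    define p where "p = (y - x) /\<^sub>R t"
    \<comment> \<open>Positivity holds because \<open>f x < f y\<close> excludes
      \<open>y = x\<close>.\<close>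
    have t: "0 < t" "t < d"
      using y by (auto simp: t_def dist_norm)
    then have p: "norm p = 1" and yeq: "y = x + t *\<^sub>R p"
      by (auto simp: p_def simp flip: t_def)
    have "f x < f x + t * min_slope x p"
      using near[OF p t] y(1) yeq by simp
    then have "0 < min_slope x p"
      using t(1) by (simp add: zero_less_mult_iff)
    moreover have "v \<in> (\<Inter>i\<in>active_dir X I fi f x p. Argmax (\<lambda>v. v \<bullet> p) (frechet_subdiff X (fi i) x))"
      using near[OF p t] y(3) yeq by simp
    ultimately show "v \<in> ?L"
      using p by (auto simp: hadamard_deriv_f[OF x])
  }
qed

end

theorem theorem3:
  fixes X :: "(real ^ 'n) set" and xbar :: "real ^ 'n"
    and I :: "'i set" and J :: "'i \<Rightarrow> 'j set"
    and a :: "'i \<Rightarrow> 'j \<Rightarrow> real ^ 'n" and b :: "'i \<Rightarrow> 'j \<Rightarrow> real"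
    and fi :: "'i \<Rightarrow> real ^ 'n \<Rightarrow> real" and f :: "real ^ 'n \<Rightarrow> real"
  assumes "open X" and "xbar \<in> X"
    and "finite I" and "I \<noteq> {}"
    and "\<And>i. i \<in> I \<Longrightarrow> finite (J i)" and "\<And>i. i \<in> I \<Longrightarrow> J i \<noteq> {}"
    and "\<And>i x. i \<in> I \<Longrightarrow> x \<in> X \<Longrightarrow> fi i x = (MAX j\<in>J i. a i j \<bullet> x + b i j)"
    and "\<And>x. x \<in> X \<Longrightarrow> f x = (MIN i\<in>I. fi i x)"
  shows "(\<Union>p\<in>{p \<in> sphere 0 1. hadamard_deriv X f xbar p > 0}.
            \<Inter>i\<in>active_dir X I fi f xbar p.
              Argmax (\<lambda>v. v \<bullet> p) (frechet_subdiff X (fi i) xbar))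
         = outer_limit_subdiff X f xbar"
proof -
  interpret min_max_affine X I J a b fi f
    using assms by unfold_locales (auto simp: max_affine_def)
  show ?thesis
    using \<open>xbar \<in> X\<close> by (rule union_Argmax_eq_outer_limit)
qed

end
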